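(* Let $\mathbf r\in\mathcal R$ and define $\tau=2$ if $r_1=1$ and $\ell<\sigma_3-\sigma_1$, and $\tau=1$ otherwise. If $t\ge\tau$ is an integer, then $U_{\mathbf r}(t)=g_1g_2g_3\in\mathcal S$, where $g_\nu=r_\nu(\sigma_3t+\ell)+1$ ($\nu=1,2,3$), and $g_1\cdot g_2\cdot g_3$ is a strict $s$-decomposition of $U_{\mathbf r}(t)$, i.e. $s_{g_\nu}(U_{\mathbf r}(t))=g_\nu$ for $\nu=1,2,3$. Moreover, if each $g_\nu$ is an odd prime, then $U_{\mathbf r}(t)$ is a primary Carmichael number with exactly three prime factors, i.e. $U_{\mathbf r}(t)\in\mathcal C'_3$.
   Context: $\mathcal R$ is the set of triples $\mathbf r=(r_1,r_2,r_3)$ of pairwise coprime positive integers with $r_1<r_2<r_3$. For $\mathbf r\in\mathcal R$ put $\sigma_1=r_1+r_2+r_3$, $\sigma_2=r_1r_2+r_1r_3+r_2r_3$, $\sigma_3=r_1r_2r_3$, and let $\ell$ be the unique integer with $0\le\ell<\sigma_3$ and $\ell\sigma_2\equiv-\sigma_1\pmod{\sigma_3}$. Define $U_{\mathbf r}(t)=\prod_{\nu=1}^3(r_\nu(\sigma_3t+\ell)+1)$. For an integer base $g\ge2$ and $m\ge0$, $s_g(m)$ is the sum of base-$g$ digits of $m$. A strict $s$-decomposition of a positive integer $m$ is a factorization $m=\prod_{\nu=1}^n g_\nu^{e_\nu}$, $e_\nu\ge1$, with proper factors $1<g_\nu<m$, $g_1<\dots<g_n$ (not necessarily coprime) and $s_{g_\nu}(m)=g_\nu$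 for all $\nu$; $\mathcal S$ is the set of positive integers admitting one. $\mathcal C'_3$ is the set of squarefree integers $m>1$ with exactly three prime factors such that $s_p(m)=p$ for every prime $p\mid m$. *)

theory Defs
  imports "HOL-Number_Theory.Number_Theory" "HOL-Computational_Algebra.Squarefree"
begin

definition coprime_triples :: "(nat \<times> nat \<times> nat) set" where
  "coprime_triples = {(r1, r2, r3). 0 < r1 \<and> r1 < r2 \<and> r2 < r3 \<and>
     coprime r1 r2 \<and> coprime r1 r3 \<and> coprime r2 r3}"

fun sigma1 :: "nat \<times> nat \<times> nat \<Rightarrow> nat" where
  "sigma1 (r1, r2, r3) = r1 + r2 + r3"

fun sigma2 :: "nat \<times> nat \<times> nat \<Rightarrow> nat" where
  "sigma2 (r1, r2, r3) = r1 * r2 + r1 * r3 + r2 * r3"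

fun sigma3 :: "nat \<times> nat \<times> nat \<Rightarrow> nat" where
  "sigma3 (r1, r2, r3) = r1 * r2 * r3"

definition ell :: "nat \<times> nat \<times> nat \<Rightarrow> nat" where
  "ell r = (THE l. l < sigma3 r \<and>
     [int l * int (sigma2 r) = - int (sigma1 r)] (mod int (sigma3 r)))"

text \<open>The description defining \<^const>\<open>ell\<close> is proper on \<^const>\<open>coprime_triples\<close>.\<close>

lemma coprime_sigma2_sigma3:
  assumes "r \<in> coprime_triples"
  shows "coprime (sigma2 r) (sigma3 r)"
proof -
  obtain a b c where r: "r = (a, b, c)" by (cases r)
  have cp: "coprime a b" "coprime a c" "coprime b c"
    using assms by (auto simp: r coprime_triples_def)
  have *: "coprime (x * y + w * z) w" if "coprime x w" "coprime y w" for w x y z :: nat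
  proof (rule coprimeI)
    fix d assume "d dvd x * y + w * z" "d dvd w"
    then have "d dvd x * y" by (metis dvd_add_left_iff dvd_mult2)
    moreover have "coprime (x * y) w" using that by simp
    ultimately show "is_unit d"
      using \<open>d dvd w\<close> coprime_common_divisor by blast
  qed
  have "coprime (b * c + a * (b + c)) a" "coprime (a * c + b * (a + c)) b"
    "coprime (a * b + c * (a + b)) c"
    by (rule *; use cp in \<open>simp add: coprime_commute\<close>)+
  moreover have "sigma2 r = b * c + a * (b + c)" "sigma2 r = a * c + b * (a + c)"
    "sigma2 r = a * b + c * (a + b)"
    by (simp_all add: r algebra_simps)
  ultimately have "coprime (sigma2 r) a" "coprime (sigma2 r) b" "coprime (sigma2 r) c"
    by simp_all
  then show ?thesis
    by (simp add: r del: sigma2.simps)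
qed

lemma ell_ex1:
  assumes "r \<in> coprime_triples"
  shows "\<exists>!l. l < sigma3 r \<and>
     [int l * int (sigma2 r) = - int (sigma1 r)] (mod int (sigma3 r))"
proof -
  have pos: "int (sigma3 r) > 0"
    using assms by (auto simp: coprime_triples_def)
  have cop: "coprime (int (sigma2 r)) (int (sigma3 r))"
    using coprime_sigma2_sigma3[OF assms] by simp
  then obtain x where x: "[int (sigma2 r) * x = 1] (mod int (sigma3 r))"
    using cong_solve_coprime_int by blast
  define l where "l = nat ((- int (sigma1 r) * x) mod int (sigma3 r))"
  have l_int: "int l = (- int (sigma1 r) * x) mod int (sigma3 r)"
    using pos by (simp add: l_def)
  have "[int l = - int (sigma1 r) * x] (mod int (sigma3 r))"
    by (simp add: l_int cong_def)
  then have "[int l * int (sigma2 r) = - int (sigma1 r) * x * int (sigma2 r)] (mod int (sigma3 r))"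
    by (rule cong_scalar_right)
  moreover have "[- int (sigma1 r) * (int (sigma2 r) * x) = - int (sigma1 r) * 1] (mod int (sigma3 r))"
    using x by (rule cong_scalar_left)
  ultimately have c: "[int l * int (sigma2 r) = - int (sigma1 r)] (mod int (sigma3 r))"
    by (simp add: ac_simps cong_trans)
  have "int l < int (sigma3 r)"
    using pos by (simp add: l_int)
  then have "l < sigma3 r" by simp
  moreover have "k = l"
    if "k < sigma3 r" "[int k * int (sigma2 r) = - int (sigma1 r)] (mod int (sigma3 r))" for k
  proof -
    have "[int k * int (sigma2 r) = int l * int (sigma2 r)] (mod int (sigma3 r))"
      using that(2) c cong_sym cong_trans by blast
    then have "[int k = int l] (mod int (sigma3 r))"
      using cop by (simp add: cong_mult_rcancel)
    then have "[k = l] (mod sigma3 r)" by (simp add: cong_int_iff)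
    then show "k = l"
      using that(1) \<open>l < sigma3 r\<close> by (simp add: cong_less_modulus_unique_nat)
  qed
  ultimately show ?thesis using c by blast
qed

lemma ell_props:
  assumes "r \<in> coprime_triples"
  shows "ell r < sigma3 r"
    and "[int (ell r) * int (sigma2 r) = - int (sigma1 r)] (mod int (sigma3 r))"
  using theI'[OF ell_ex1[OF assms]] unfolding ell_def by blast+

fun U_poly :: "nat \<times> nat \<times> nat \<Rightarrow> nat \<Rightarrow> nat" where
  "U_poly (r1, r2, r3) t =
     (r1 * (sigma3 (r1, r2, r3) * t + ell (r1, r2, r3)) + 1) *
     (r2 * (sigma3 (r1, r2, r3) * t + ell (r1, r2, r3)) + 1) *
     (r3 * (sigma3 (r1, r2, r3) * t + ell (r1, r2, r3)) + 1)"

definition tau :: "nat \<times> nat \<times> nat \<Rightarrow> nat" where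
  "tau r = (if fst r = 1 \<and> int (ell r) < int (sigma3 r) - int (sigma1 r) then 2 else 1)"

text \<open>Base-\<open>g\<close> digit sum of \<open>m\<close>; the value for the meaningless bases \<open>g < 2\<close> is set to 0.\<close>

function digit_sum :: "nat \<Rightarrow> nat \<Rightarrow> nat" where
  "digit_sum g m = (if g < 2 \<or> m = 0 then 0 else m mod g + digit_sum g (m div g))"
  by auto
termination
  by (relation "Wellfounded.measure snd") auto

declare digit_sum.simps [simp del]

text \<open>
  A strict s-decomposition \<open>m = g\<^sub>1 ^ e\<^sub>1 * \<dots> * g\<^sub>n ^ e\<^sub>n\<close> is represented by the list
  \<open>[(g\<^sub>1, e\<^sub>1), \<dots>, (g\<^sub>n, e\<^sub>n)]\<close>. Nonemptiness (\<open>n \<ge> 1\<close>) only excludes the empty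
  product, which would otherwise decompose \<open>m = 1\<close>.
\<close>

definition strict_s_decomposition :: "nat \<Rightarrow> (nat \<times> nat) list \<Rightarrow> bool" where
  "strict_s_decomposition m ds \<longleftrightarrow>
     ds \<noteq> [] \<and>
     m = (\<Prod>(g, e)\<leftarrow>ds. g ^ e) \<and>
     sorted_wrt (<) (map fst ds) \<and>
     (\<forall>(g, e)\<in>set ds. 1 < g \<and> g < m \<and> 1 \<le> e \<and> digit_sum g m = g)"

definition s_decomposable :: "nat set" where
  "s_decomposable = {m. 0 < m \<and> (\<exists>ds. strict_s_decomposition m ds)}"

definition primary_carmichael3 :: "nat set" where
  "primary_carmichael3 = {m. 1 < m \<and> squarefree m \<and> card (prime_factors m) = 3 \<and>
     (\<forall>p. prime p \<and> p dvd m \<longrightarrow> digit_sum p m = p)}"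

end

theory Submission
  imports Defs
begin

text \<open>
  Fix one factor \<open>g = a * N + 1\<close> and let \<open>b * N + 1\<close>, \<open>c * N + 1\<close> be the other two. The congruence
  for \<open>\<ell>\<close> gives \<open>b * c * N + b + c = a * k\<close> for some \<open>k\<close>, so that
  \<open>(b * N + 1) * (c * N + 1) = (g - 1) * k + 1\<close>. If \<open>k - 1 = q * g + s\<close> with \<open>1 \<le> s < g\<close> and
  \<open>q \<le> s\<close>, then this number has the base-\<open>g\<close> digits \<open>q, s - q, g - s\<close>, whose sum is \<open>g\<close>.
  Since \<open>a\<^sup>2 * (k - 1) = b * c * g - (b - a) * (c - a)\<close>, the quotient \<open>q\<close> is
  \<open>\<lfloor>b * c / a\<^sup>2\<rfloor>\<close> for \<open>a \<ge> 2\<close> and \<open>b * c - 1\<close> for \<open>a = 1\<close>. In the latter case the inequality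
  \<open>q \<le> s\<close> becomes \<open>g \<ge> 2 * b * c - b - c\<close>, and this is what \<open>\<tau>\<close> guarantees.
\<close>

section \<open>Digit expansions in base \<open>g\<close>\<close>

lemma digit_sum_cons:
  assumes "2 \<le> g" "d < g"
  shows "digit_sum g (d + g * m) = d + digit_sum g m"
proof (cases "d + g * m = 0")
  case True
  then show ?thesis using assms by (simp add: digit_sum.simps)
next
  case False
  then show ?thesis
    using assms by (subst digit_sum.simps) (auto simp: div_mult_self2)
qed

lemma digit_sum_base_mult:
  assumes "2 \<le> g"
  shows "digit_sum g (g * m) = digit_sum g m"
  using digit_sum_cons[OF assms, of 0 m] assms by simp

lemma digit_sum_less:
  assumes "2 \<le> g" "d < g"
  shows "digit_sum g d = d"
  using digit_sum_cons[OF assms, of 0] by (simp add: digit_sum.simps)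

lemma digit_sum_base_times_factors:
  fixes a b c N g q s :: nat
  assumes g: "g = a * N + 1"
    and k: "b * c * N + b + c = a * (q * g + s + 1)"
    and s: "1 \<le> s" "s < g" and qs: "q \<le> s"
  shows "digit_sum g (g * ((b * N + 1) * (c * N + 1))) = g"
proof -
  have "(b * N + 1) * (c * N + 1) = N * (b * c * N + b + c) + 1"
    by (simp add: algebra_simps)
  also have "\<dots> = (a * N) * (q * g + s + 1) + 1"
    unfolding k by (simp add: algebra_simps)
  \<comment> \<open>The digits are truncated differences, so the identity is checked over the
    integers, where \<open>a * N\<close> becomes \<open>g - 1\<close>.\<close>
  also have "int \<dots> = int ((g - s) + g * ((s - q) + g * q))"
  proof -
    have "int (a * N) = int g - 1" using g by simp
    moreover have "int (g - s) = int g - int s" "int (s - q) = int s - int q"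
      using s qs by auto
    ultimately show ?thesis
      by (simp only: of_nat_add of_nat_mult of_nat_1) (simp add: algebra_simps)
  qed
  finally have m: "(b * N + 1) * (c * N + 1) = (g - s) + g * ((s - q) + g * q)"
    by (simp only: of_nat_eq_iff)
  have g2: "2 \<le> g" using s by simp
  \<comment> \<open>The outer factor \<open>g\<close> only appends a digit 0. The other digits are
    below \<open>g\<close> because \<open>1 \<le> s\<close> and \<open>q \<le> s < g\<close>;
    leading ones may be 0, which leaves the sum unchanged.\<close>
  have "digit_sum g (g * ((b * N + 1) * (c * N + 1))) = digit_sum g ((b * N + 1) * (c * N + 1))"
    by (rule digit_sum_base_mult[OF g2])
  also have "\<dots> = (g - s) + digit_sum g ((s - q) + g * q)"
    unfolding m using g2 s by (intro digit_sum_cons) auto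
  also have "\<dots> = (g - s) + ((s - q) + digit_sum g q)"
    using g2 s by (subst digit_sum_cons) auto
  also have "digit_sum g q = q"
    using g2 s qs by (intro digit_sum_less) auto
  finally show ?thesis using s qs by simp
qed

text \<open>With integer \<open>q\<close> and \<open>s\<close>, the remainder can be given as a
  difference whose sign is settled afterwards.\<close>

lemma digit_sum_base_times_factors_int:
  fixes a b c N g :: nat and q s :: int
  assumes "g = a * N + 1"
    and "int (b * c * N + b + c) = int a * (q * int g + s + 1)"
    and "0 \<le> q" "q \<le> s" "1 \<le> s" "s < int g"
  shows "digit_sum g (g * ((b * N + 1) * (c * N + 1))) = g"
proof (rule digit_sum_base_times_factors)
  have "int (b * c * N + b + c) = int (a * (nat q * g + nat s + 1))"
    using assms(3-5) unfolding assms(2) by (simp add: algebra_simps)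
  then show "b * c * N + b + c = a * (nat q * g + nat s + 1)"
    by (simp only: of_nat_eq_iff)
  show "nat s < g" using assms(5,6) by (simp only: nat_less_iff)
qed (use assms(1,3-5) in \<open>auto simp: nat_mono\<close>)

section \<open>Range of \<open>q\<close> and \<open>s\<close> for a single factor\<close>

text \<open>The key identity is \<open>A\<^sup>2 * s = F * G - E\<close> with
  \<open>1 \<le> F < A\<^sup>2\<close>: up to the correction \<open>E\<close>, \<open>s\<close> is a
  proper fraction of \<open>G\<close>. The bound on \<open>N\<close> makes \<open>G\<close> large
  enough to absorb \<open>E\<close> and to give \<open>Q \<le> s\<close>.\<close>

lemma digit_sum_factor_ge_two:
  fixes a b c N g :: nat
  assumes g: "g = a * N + 1" and a: "2 \<le> a" and bc: "0 < b" "0 < c"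
    and cop: "coprime a b" "coprime a c"
    and dvd: "a dvd b * c * N + b + c"
    and N: "a * b * c \<le> N"
  shows "digit_sum g (g * ((b * N + 1) * (c * N + 1))) = g"
proof -
  obtain k where k: "b * c * N + b + c = a * k" using dvd by (elim dvdE)
  define q where "q = (b * c) div a\<^sup>2"
  define f where "f = (b * c) mod a\<^sup>2"
  have qf: "b * c = a\<^sup>2 * q + f" by (simp add: q_def f_def)
  \<comment> \<open>Otherwise the dominant term \<open>F * G\<close> would vanish; coprimality of
    \<open>a\<close> to \<open>b * c\<close> excludes this.\<close>
  have "f \<noteq> 0"
  proof
    assume "f = 0"
    then have "a dvd b * c" using qf by (simp add: power2_eq_square)
    moreover have "coprime a (b * c)" using cop by simp
    ultimately have "a = 1" by (metis coprime_absorb_left nat_dvd_1_iff_1)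
    with a show False by simp
  qed
  then have "0 < f" by simp
  define A B C G M F Q where "A = int a" "B = int b" "C = int c" "G = int g" "M = int N"
    "F = int f" "Q = int q"
  note defs = A_B_C_G_M_F_Q_def
  have f1: "1 \<le> F" using \<open>0 < f\<close> by (simp add: defs)
  have fa: "F + 1 \<le> A\<^sup>2"
  proof -
    have "f < a\<^sup>2" using a by (simp add: f_def)
    then have "int f + 1 \<le> int (a\<^sup>2)" by linarith
    then show ?thesis by (simp add: defs)
  qed
  have pos: "2 \<le> A" "1 \<le> B" "1 \<le> C" using a bc by (auto simp: defs)
  have G: "G = A * M + 1" by (simp add: defs g)
  have K: "B * C * M + B + C = A * int k"
    using arg_cong[OF k, of int] by (simp add: defs)
  have QF: "B * C = A\<^sup>2 * Q + F"
    using arg_cong[OF qf, of int] by (simp add: defs)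
  define s E L where "s = int k - 1 - Q * G" "E = (B - A) * (C - A)" "L = A * (B + C)"
  note s_def = s_E_L_def(1) and E_def = s_E_L_def(2) and L_def = s_E_L_def(3)
  have "A\<^sup>2 * (int k - 1) = A * (B * C * M + B + C) - A\<^sup>2"
    unfolding K by (simp add: power2_eq_square algebra_simps)
  also have "\<dots> = B * C * G - (B - A) * (C - A)"
    by (simp add: G power2_eq_square algebra_simps)
  finally have s: "A\<^sup>2 * s = F * G - E"
    by (simp add: E_def s_def QF algebra_simps)
  have "A * (A * B * C) \<le> A * M"
    using N pos by (intro mult_left_mono) (simp_all add: defs flip: of_nat_mult)
  then have G1: "A\<^sup>2 * (B * C) + 1 \<le> G" by (simp add: G power2_eq_square algebra_simps)
  have A4: "4 \<le> A\<^sup>2" using power_mono[of 2 A 2] pos by simp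
  then have A0: "0 < A\<^sup>2" by linarith
  have BC1: "1 \<le> B * C" using mult_mono[of 1 B 1 C] pos by simp
  \<comment> \<open>Together with \<open>G1\<close> this yields
    \<open>2 * (B * C) + A\<^sup>2 \<le> G + 1\<close>.\<close>
  have "0 \<le> (A\<^sup>2 - 2) * (B * C - 1)" using A4 BC1 by simp
  then have x: "2 * (B * C) + A\<^sup>2 \<le> A\<^sup>2 * (B * C) + 2" by (simp add: algebra_simps)
  have e: "E = B * C + A\<^sup>2 - L"
    by (simp add: E_def L_def power2_eq_square algebra_simps)
  have ABC: "4 \<le> L" unfolding L_def using mult_mono[of 2 A 2 "B + C"] pos by simp
  have G0: "0 \<le> G" by (simp add: defs)
  have "1 * (G + 1) \<le> F * (G + 1)" using f1 G0 by (intro mult_right_mono) auto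
  then have fG: "G + 1 \<le> F * G + F" by (simp add: algebra_simps)
  \<comment> \<open>After substituting for \<open>A\<^sup>2 * Q\<close> and \<open>E\<close>, the
    claim reads \<open>2 * (B * C) + A\<^sup>2 \<le> F * G + F + L\<close>.\<close>
  have "A\<^sup>2 * Q \<le> A\<^sup>2 * s"
    using s QF fG e ABC x G1 by linarith
  then have qs: "Q \<le> s" using A0 by (simp only: mult_le_cancel_left_pos)
  have "1 * G \<le> F * G" using f1 G0 by (intro mult_right_mono)
  then have "G \<le> F * G" by simp
  then have "A\<^sup>2 * 0 < A\<^sup>2 * s" using s e ABC x G1 BC1 by linarith
  then have "0 < s" using A0 by (simp only: mult_less_cancel_left_pos)
  then have s1: "1 \<le> s" by simp
  \<comment> \<open>For \<open>s < G\<close>: since \<open>F + 1 \<le> A\<^sup>2\<close>, one copy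
    of \<open>G\<close> is left over, and it dominates \<open>- E < L\<close>.\<close>
  have "A * (B + C) \<le> A * (A * B * C)"
  proof (intro mult_left_mono)
    have "0 \<le> (B - 1) * (C - 1) + (B * C - 1)" using pos BC1 by simp
    then have "B + C \<le> 2 * (B * C)" by (simp add: algebra_simps)
    also have "\<dots> \<le> A * (B * C)" using pos BC1 by (intro mult_right_mono) auto
    finally show "B + C \<le> A * B * C" by (simp add: mult.assoc)
  qed (use pos in auto)
  then have "L < G" using G1 by (simp add: L_def power2_eq_square mult.assoc)
  moreover have "(F + 1) * G \<le> A\<^sup>2 * G" using fa G0 by (rule mult_right_mono)
  then have "F * G + G \<le> A\<^sup>2 * G" by (simp add: algebra_simps)
  ultimately have "A\<^sup>2 * s < A\<^sup>2 * G"
    using s e BC1 A0 by linarith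
  then have sG: "s < G" using A0 by (simp only: mult_less_cancel_left_pos)
  show ?thesis
  proof (rule digit_sum_base_times_factors_int[OF g])
    show "int (b * c * N + b + c) = int a * (Q * int g + s + 1)"
      using K by (simp add: s_def defs)
  qed (use qs s1 sG in \<open>simp_all add: defs\<close>)
qed

text \<open>Here \<open>k - 1 = b * c * g - (b - 1) * (c - 1)\<close>. The subtracted term is
  positive, so one \<open>g\<close> is borrowed and the quotient drops to \<open>b * c - 1\<close>.
  The bound on \<open>N\<close> is \<open>q \<le> s\<close> rearranged.\<close>

lemma digit_sum_factor_one:
  fixes b c N g :: nat
  assumes g: "g = N + 1" and bc: "2 \<le> b" "2 \<le> c"
    and N: "2 * b * c \<le> N + 1 + b + c"
  shows "digit_sum g (g * ((b * N + 1) * (c * N + 1))) = g"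
proof -
  define B C G where "B = int b" "C = int c" "G = int g"
  note defs = B_C_G_def
  have "2 * B * C \<le> G + B + C"
    using of_nat_mono[OF N, where 'a = int] by (simp add: defs g)
  moreover have pos: "2 \<le> B" "2 \<le> C" using bc by (auto simp: defs)
  moreover have "4 \<le> B * C" using mult_mono[of 2 B 2 C] pos by simp
  moreover have "1 \<le> (B - 1) * (C - 1)" using mult_mono[of 1 "B - 1" 1 "C - 1"] pos by simp
  ultimately have ineqs: "0 \<le> B * C - 1" "B * C - 1 \<le> G - (B - 1) * (C - 1)"
    "1 \<le> G - (B - 1) * (C - 1)" "G - (B - 1) * (C - 1) < G"
    by (simp_all add: algebra_simps)
  have "int (b * c * N + b + c) = int 1 * ((B * C - 1) * int g + (G - (B - 1) * (C - 1)) + 1)"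
    by (simp add: defs g algebra_simps)
  with ineqs g show ?thesis
    by (intro digit_sum_base_times_factors_int[where a = 1 and q = "B * C - 1"
          and s = "G - (B - 1) * (C - 1)"]) (simp_all add: defs)
qed

section \<open>From the triple to the three factors\<close>

text \<open>The congruence defining \<open>ell\<close> persists when multiples of
  \<open>sigma3 r\<close> are added. Reduced modulo each entry of the triple, it supplies the
  divisibility behind \<open>k\<close>.\<close>

lemma sigma3_dvd_sigma2_mult_add_sigma1:
  assumes "r \<in> coprime_triples"
  shows "sigma3 r dvd sigma2 r * (sigma3 r * t + ell r) + sigma1 r"
proof -
  have "int (sigma3 r) dvd int (ell r) * int (sigma2 r) + int (sigma1 r)"
    using ell_props(2)[OF assms] by (simp add: cong_iff_dvd_diff)
  then have "sigma3 r dvd ell r * sigma2 r + sigma1 r"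
    by (metis of_nat_add of_nat_dvd_iff of_nat_mult)
  then have "sigma3 r dvd sigma3 r * (sigma2 r * t) + (ell r * sigma2 r + sigma1 r)"
    by simp
  then show ?thesis by (simp add: algebra_simps)
qed

text \<open>The strict order makes the primes distinct, so they are exactly the prime divisors, each
  with multiplicity one.\<close>

lemma three_primes_primary_carmichael3:
  fixes p q r :: nat
  assumes prime: "prime p" "prime q" "prime r" and less: "p < q" "q < r"
    and digit_sum: "\<And>x. x \<in> {p, q, r} \<Longrightarrow> digit_sum x (p * q * r) = x"
  shows "p * q * r \<in> primary_carmichael3"
proof -
  have nz: "p \<noteq> 0" "q \<noteq> 0" "r \<noteq> 0" and gt: "1 < p" "1 < q" "1 < r"
    using prime prime_gt_1_nat by auto
  have "coprime p q" "coprime p r" "coprime q r"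
    using prime less by (auto intro!: primes_coprime)
  then have "squarefree (p * q * r)"
    using prime by (intro squarefree_mult_coprime squarefree_prime) auto
  moreover have pf: "prime_factors (p * q * r) = {p, q, r}"
    using prime nz by (simp add: prime_factors_product prime_prime_factors insert_commute)
  moreover have "card (prime_factors (p * q * r)) = 3"
    using less unfolding pf by simp
  moreover have "1 < p * q * r" using gt by (intro less_1_mult)
  moreover have "digit_sum x (p * q * r) = x" if "prime x" "x dvd p * q * r" for x
  proof (rule digit_sum)
    have "x \<in> prime_factors (p * q * r)" using that nz by (simp add: in_prime_factors_iff)
    then show "x \<in> {p, q, r}" unfolding pf .
  qed
  ultimately show ?thesis unfolding primary_carmichael3_def by blast
qed

theorem theorem4p4:
  fixes r1 r2 r3 t g1 g2 g3 :: nat and r :: "nat \<times> nat \<times> nat"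
  assumes "r = (r1, r2, r3)" and "r \<in> coprime_triples"
    and "t \<ge> tau r"
    and "g1 = r1 * (sigma3 r * t + ell r) + 1"
    and "g2 = r2 * (sigma3 r * t + ell r) + 1"
    and "g3 = r3 * (sigma3 r * t + ell r) + 1"
  shows "U_poly r t = g1 * g2 * g3 \<and>
    U_poly r t \<in> s_decomposable \<and>
    strict_s_decomposition (U_poly r t) [(g1, 1), (g2, 1), (g3, 1)] \<and>
    digit_sum g1 (U_poly r t) = g1 \<and>
    digit_sum g2 (U_poly r t) = g2 \<and>
    digit_sum g3 (U_poly r t) = g3 \<and>
    ((prime g1 \<and> odd g1) \<and> (prime g2 \<and> odd g2) \<and> (prime g3 \<and> odd g3) \<longrightarrow>
      U_poly r t \<in> primary_carmichael3)"
proof -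
  define N where "N = sigma3 r * t + ell r"
  note g = assms(4-6)[folded N_def]
  have ord: "0 < r1" "r1 < r2" "r2 < r3"
    and cop: "coprime r1 r2" "coprime r1 r3" "coprime r2 r3"
    using assms(1,2) by (auto simp: coprime_triples_def)
  have U: "U_poly r t = g1 * g2 * g3"
    using assms(1) g by (simp add: N_def)
  have t1: "1 \<le> t" using assms(3) by (auto simp: tau_def split: if_splits)
  have "sigma3 r * 1 \<le> N"
    unfolding N_def using t1 by (intro trans_le_add1 mult_left_mono) auto
  then have N3: "r1 * r2 * r3 \<le> N" using assms(1) by simp
  have "0 < r1 * r2 * r3" using ord by simp
  then have Npos: "0 < N" using N3 by linarith
  have dvd: "r1 * r2 * r3 dvd (r1 * r2 + r1 * r3 + r2 * r3) * N + (r1 + r2 + r3)"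
    using sigma3_dvd_sigma2_mult_add_sigma1[OF assms(2), of t] assms(1) by (simp add: N_def)
  have dvd1: "r1 dvd r2 * r3 * N + r2 + r3"
  proof -
    have "r1 dvd r1 * (r2 * N + r3 * N + 1) + (r2 * r3 * N + r2 + r3)"
      using dvd_trans[OF _ dvd, of r1] by (simp add: algebra_simps)
    then show ?thesis by (metis dvd_add_right_iff dvd_triv_left)
  qed
  have dvd2: "r2 dvd r1 * r3 * N + r1 + r3"
  proof -
    have "r2 dvd r2 * (r1 * N + r3 * N + 1) + (r1 * r3 * N + r1 + r3)"
      using dvd_trans[OF _ dvd, of r2] by (simp add: algebra_simps)
    then show ?thesis by (metis dvd_add_right_iff dvd_triv_left)
  qed
  have dvd3: "r3 dvd r1 * r2 * N + r1 + r2"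
  proof -
    have "r3 dvd r3 * (r1 * N + r2 * N + 1) + (r1 * r2 * N + r1 + r2)"
      using dvd_trans[OF _ dvd, of r3] by (simp add: algebra_simps)
    then show ?thesis by (metis dvd_add_right_iff dvd_triv_left)
  qed
  have ds1: "digit_sum g1 (g1 * (g2 * g3)) = g1"
  proof (cases "r1 = 1")
    case True
    \<comment> \<open>If \<open>t = 1\<close>, then \<open>tau r = 1\<close> forces
      \<open>ell r \<ge> sigma3 r - sigma1 r\<close>, so
      \<open>N \<ge> 2 * sigma3 r - sigma1 r\<close>, which is exactly the bound. For larger
      \<open>t\<close>, already \<open>N \<ge> 2 * sigma3 r\<close>.\<close>
    have "2 * r2 * r3 \<le> N + 1 + r2 + r3"
    proof (cases "t = 1")
      case True
      then have "int (sigma3 r) - int (sigma1 r) \<le> int (ell r)"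
        using assms(1,3) \<open>r1 = 1\<close> by (auto simp: tau_def split: if_splits)
      then have "sigma3 r \<le> ell r + sigma1 r" by linarith
      then show ?thesis using assms(1) \<open>r1 = 1\<close> \<open>t = 1\<close> by (simp add: N_def)
    next
      case False
      then have "sigma3 r * 2 \<le> N"
        unfolding N_def using t1 by (intro trans_le_add1 mult_left_mono) auto
      then show ?thesis using assms(1) \<open>r1 = 1\<close> by simp
    qed
    then show ?thesis
      using digit_sum_factor_one[of g1 N r2 r3] True ord g by simp
  next
    case False
    then show ?thesis
      using digit_sum_factor_ge_two[of g1 r1 N r2 r3] ord cop dvd1 N3 g by simp
  qed
  \<comment> \<open>Both \<open>r2\<close> and \<open>r3\<close> exceed \<open>r1 \<ge> 1\<close>,
    so they are at least 2 and need no case split.\<close>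
  have ds2: "digit_sum g2 (g2 * (g1 * g3)) = g2"
    unfolding g(1,3) by (rule digit_sum_factor_ge_two[OF g(2)])
      (use ord cop dvd2 N3 in \<open>simp_all add: coprime_commute ac_simps\<close>)
  have ds3: "digit_sum g3 (g3 * (g1 * g2)) = g3"
    unfolding g(1,2) by (rule digit_sum_factor_ge_two[OF g(3)])
      (use ord cop dvd3 N3 in \<open>simp_all add: coprime_commute ac_simps\<close>)
  have ds: "digit_sum g1 (g1 * g2 * g3) = g1" "digit_sum g2 (g1 * g2 * g3) = g2"
    "digit_sum g3 (g1 * g2 * g3) = g3"
    using ds1 ds2 ds3 by (simp_all add: ac_simps)
  have lt: "1 < g1" "g1 < g2" "g2 < g3" using ord Npos g by simp_all
  have proper: "x < x * y * z" if "1 < x" "1 < y" "1 < z" for x y z :: nat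
    using that less_1_mult[of y z] by (simp add: mult.assoc)
  have "g1 < g1 * g2 * g3" "g2 < g1 * g2 * g3" "g3 < g1 * g2 * g3"
    using proper[of g1 g2 g3] proper[of g2 g1 g3] proper[of g3 g1 g2] lt
    by (simp_all add: ac_simps)
  then have dec: "strict_s_decomposition (g1 * g2 * g3) [(g1, 1), (g2, 1), (g3, 1)]"
    using ds lt by (simp add: strict_s_decomposition_def mult.assoc)
  moreover have "g1 * g2 * g3 \<in> s_decomposable"
    using dec lt unfolding s_decomposable_def by auto
  moreover have "g1 * g2 * g3 \<in> primary_carmichael3" if "prime g1" "prime g2" "prime g3"
    using that lt ds by (intro three_primes_primary_carmichael3) auto
  ultimately show ?thesis using U ds by simp
qed

end
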